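(* In the sensor selection setting of the context, consider the following problems in the Boolean variables $\gamma_{k+n}^i$, $i=1,\ldots,L$, $n=1,\ldots,N$, subject to $\sum_{i=1}^L\gamma_{k+n}^i=m_{k+n}$ and $\gamma_{k+n}^i\in\{0,1\}$ for all $i,n$. (F) Minimize the final error covariance matrix $\mathbf{P}_{k+N|k+N}$ (in the Loewner order). (A) Minimize the matrix $\sum_{n=1}^N\mathbf{P}_{k+n|k+n}$ (in the Loewner order). (T) For each $n=1,\ldots,N$ separately, maximize the scalar $\mathrm{tr}\bigl(\tilde{\mathbf{H}}_{k+n}'\tilde{\mathbf{R}}_{k+n}^{+}\tilde{\mathbf{H}}_{k+n}\bigr)$ over $(\gamma_{k+n}^1,\ldots,\gamma_{k+n}^L)\in\{0,1\}^L$ with $\sum_{i=1}^L\gamma_{k+n}^i=m_{k+n}$. If problem (F) has an optimal solution, then both (F) and (A) are equivalent to (T), i.e. the three problems (F), (A), (T) have the same optimal solutions: a feasible family $(\gamma_{k+n}^i)_{i,n}$ is optimal for (F) if and only if it is optimal for (A), if and only if for every $n$ the vector $(\gamma_{k+n}^1,\ldots,\gamma_{k+n}^L)$ is optimal for the $n$-th problem in (T).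
   Context: All matrices are real; prime denotes transpose, and the superscript $+$ denotes the Moore-Penrose generalized inverse. $A\succeq B$ (Loewner order) means $A-B$ is symmetric positive semidefinite. A feasible point $x^*$ is an optimal solution of a problem of minimizing a matrix-valued function $M$ if $M(x)\succeq M(x^* )$ for every feasible $x$ (so an optimal solution need not exist). Setting: Fix $k$, a horizon $N\ge 1$, a number of sensors $L$, and integers $0\le m_{k+n}\le L$, $n=1,\ldots,N$. The matrices $\mathbf{F}_{j}\in\mathbb{R}^{r\times r}$ are invertible, the $\mathbf{Q}_j\in\mathbb{R}^{r\times r}$ are invertible covariance matrices (symmetric positive definite), $\mathbf{H}_j^i\in\mathbb{R}^{n_i\times r}$, and $\mathbf{R}_j=(\mathbf{R}_j^{is})_{i,s=1}^L$ (blocks $\mathbf{R}_j^{is}\in\mathbb{R}^{n_i\times n_s}$) are invertible covariance matrices (symmetric positive definite). These come from the system $\mathbf{x}_{j+1}=\mathbf{F}_j\mathbf{x}_j+\mathbf{w}_j$, $\mathbf{y}_j^i=\mathbf{H}_j^i\mathbf{x}_j+\mathbf{v}_j^i$, with $\mathbf{Q}_j=\mathrm{Cov}(\mathbf{w}_j)$ and $\mathbf{R}_j^{is}=\mathrm{Cov}(\mathbf{v}_j^i,\mathbf{v}_j^s)$. For $\gamma_j^1,\ldots,\gamma_j^L\in\{0,1\}$ ($\gamma_j^i=1$ means that sensor $i$ is selected at time $j$), put $\tilde{\mathbf{H}}_j=((\gamma_j^1\mathbf{H}_j^1)',\ldots,(\gamma_j^L\mathbf{H}_j^L)')'$ and let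 $\tilde{\mathbf{R}}_j$ be the block matrix with blocks $\tilde{\mathbf{R}}_j^{is}=\gamma_j^i\gamma_j^s\mathbf{R}_j^{is}$. Given the error covariance $\mathbf{P}_{k|k}$ (symmetric positive semidefinite, not depending on the decision variables), the error covariances are defined recursively for $n=1,\ldots,N$ by $$\mathbf{P}_{k+n|k+n-1}=\mathbf{F}_{k+n-1}\mathbf{P}_{k+n-1|k+n-1}\mathbf{F}_{k+n-1}'+\mathbf{Q}_{k+n-1},\qquad \mathbf{P}_{k+n|k+n}=\bigl(\mathbf{P}_{k+n|k+n-1}^{-1}+\tilde{\mathbf{H}}_{k+n}'\tilde{\mathbf{R}}_{k+n}^{+}\tilde{\mathbf{H}}_{k+n}\bigr)^{-1}.$$ Thus $\mathbf{P}_{k+n|k+n}$ is a function of $\gamma_{k+1}^1,\ldots,\gamma_{k+1}^L,\ldots,\gamma_{k+n}^1,\ldots,\gamma_{k+n}^L$. *)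

theory Defs
  imports "Jordan_Normal_Form.Gauss_Jordan_Elimination"
begin

section \<open>Real matrices\<close>

text \<open>The inverse of an invertible square matrix; it is unspecified on all other matrices.\<close>

definition mat_inv :: "real mat \<Rightarrow> real mat" where
  "mat_inv A = the (mat_inverse A)"

definition is_pseudoinverse :: "real mat \<Rightarrow> real mat \<Rightarrow> bool" where
  "is_pseudoinverse A X \<longleftrightarrow>
     X \<in> carrier_mat (dim_col A) (dim_row A) \<and>
     A * X * A = A \<and> X * A * X = X \<and> (A * X)\<^sup>T = A * X \<and> (X * A)\<^sup>T = X * A"

definition pseudoinverse :: "real mat \<Rightarrow> real mat" where
  "pseudoinverse A = (THE X. is_pseudoinverse A X)"

definition mat_trace :: "real mat \<Rightarrow> real" where
  "mat_trace A = (\<Sum>i<dim_row A. A $$ (i, i))"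

text \<open>In the next two definitions the equation \<open>A\<^sup>T = A\<close> also forces \<open>A\<close> to be square.\<close>

definition pos_semidef :: "real mat \<Rightarrow> bool" where
  "pos_semidef A \<longleftrightarrow> A\<^sup>T = A \<and> (\<forall>v \<in> carrier_vec (dim_row A). v \<bullet> (A *\<^sub>v v) \<ge> 0)"

definition pos_def :: "real mat \<Rightarrow> bool" where
  "pos_def A \<longleftrightarrow> A\<^sup>T = A \<and>
     (\<forall>v \<in> carrier_vec (dim_row A). v \<noteq> 0\<^sub>v (dim_row A) \<longrightarrow> v \<bullet> (A *\<^sub>v v) > 0)"

definition loewner_ge :: "real mat \<Rightarrow> real mat \<Rightarrow> bool" (infix "\<succeq>\<^sub>L" 50) where
  "A \<succeq>\<^sub>L B \<longleftrightarrow> pos_semidef (A - B)"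

definition is_loewner_min :: "('x \<Rightarrow> bool) \<Rightarrow> ('x \<Rightarrow> real mat) \<Rightarrow> 'x \<Rightarrow> bool" where
  "is_loewner_min feas M x \<longleftrightarrow> feas x \<and> (\<forall>y. feas y \<longrightarrow> M y \<succeq>\<^sub>L M x)"

section \<open>Block matrices\<close>

text \<open>
  Blocks are numbered from 1. For block sizes \<open>d 1, \<dots>, d l\<close>, the list \<open>block_index d l\<close>
  gives for each row (or column) of the assembled matrix its block number and its position
  inside that block, the latter counted from 0 as usual for \<^typ>\<open>real mat\<close>.
\<close>

definition block_index :: "(nat \<Rightarrow> nat) \<Rightarrow> nat \<Rightarrow> (nat \<times> nat) list" where
  "block_index d l = concat (map (\<lambda>i. map (Pair i) [0..<d i]) [1..<l + 1])"

text \<open>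
  The matrix with \<open>l\<close> block rows and \<open>l'\<close> block columns whose block \<open>(i, s)\<close> is the
  \<open>d i \<times> d' s\<close> matrix \<open>B i s\<close>.
\<close>

definition block_matrix ::
  "(nat \<Rightarrow> nat) \<Rightarrow> nat \<Rightarrow> (nat \<Rightarrow> nat) \<Rightarrow> nat \<Rightarrow> (nat \<Rightarrow> nat \<Rightarrow> real mat) \<Rightarrow> real mat" where
  "block_matrix d l d' l' B =
     mat (length (block_index d l)) (length (block_index d' l'))
       (\<lambda>(p, q). case (block_index d l ! p, block_index d' l' ! q) of
          ((i, a), (s, b)) \<Rightarrow> B i s $$ (a, b))"

section \<open>Sensor selection\<close>

text \<open>
  Here \<open>r\<close> is the state dimension, \<open>L\<close> the number of sensors (numbered \<open>1, \<dots>, L\<close>), \<open>d i\<close> the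
  measurement dimension of sensor \<open>i\<close>, and \<open>g i \<in> {0, 1}\<close> tells whether sensor \<open>i\<close> is selected.
  These definitions concern one fixed time.
\<close>

definition selected_H ::
  "nat \<Rightarrow> nat \<Rightarrow> (nat \<Rightarrow> nat) \<Rightarrow> (nat \<Rightarrow> real mat) \<Rightarrow> (nat \<Rightarrow> real) \<Rightarrow> real mat" where
  "selected_H r L d H g = block_matrix d L (\<lambda>_. r) 1 (\<lambda>i _. g i \<cdot>\<^sub>m H i)"

definition selected_R ::
  "nat \<Rightarrow> (nat \<Rightarrow> nat) \<Rightarrow> (nat \<Rightarrow> nat \<Rightarrow> real mat) \<Rightarrow> (nat \<Rightarrow> real) \<Rightarrow> real mat" where
  "selected_R L d R g = block_matrix d L d L (\<lambda>i s. (g i * g s) \<cdot>\<^sub>m R i s)"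

definition information_matrix ::
  "nat \<Rightarrow> nat \<Rightarrow> (nat \<Rightarrow> nat) \<Rightarrow> (nat \<Rightarrow> real mat) \<Rightarrow> (nat \<Rightarrow> nat \<Rightarrow> real mat) \<Rightarrow>
     (nat \<Rightarrow> real) \<Rightarrow> real mat" where
  "information_matrix r L d H R g =
     (selected_H r L d H g)\<^sup>T * pseudoinverse (selected_R L d R g) * selected_H r L d H g"

definition feasible_selection :: "nat \<Rightarrow> nat \<Rightarrow> (nat \<Rightarrow> real) \<Rightarrow> bool" where
  "feasible_selection L M g \<longleftrightarrow>
     (\<forall>i\<in>{1..L}. g i \<in> {0, 1}) \<and> (\<Sum>i=1..L. g i) = real M"

text \<open>
  \<open>error_cov F Q k P\<^sub>0 S n\<close> is the error covariance \<open>P\<^bsub>k+n|k+n\<^esub>\<close>, where \<open>P\<^sub>0 = P\<^bsub>k|k\<^esub>\<close> and \<open>S j\<close>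
  is the information matrix of the measurements selected at time \<open>j\<close>.
\<close>

primrec error_cov ::
  "(nat \<Rightarrow> real mat) \<Rightarrow> (nat \<Rightarrow> real mat) \<Rightarrow> nat \<Rightarrow> real mat \<Rightarrow> (nat \<Rightarrow> real mat) \<Rightarrow>
     nat \<Rightarrow> real mat" where
  "error_cov F Q k P\<^sub>0 S 0 = P\<^sub>0"
| "error_cov F Q k P\<^sub>0 S (Suc n) =
     mat_inv (mat_inv (F (k + n) * error_cov F Q k P\<^sub>0 S n * (F (k + n))\<^sup>T + Q (k + n))
              + S (k + Suc n))"

end

(*
  One step of the recursion, P |-> ((F P F' + Q)^-1 + S)^-1, is an order embedding in P and an order
  anti-embedding in the information matrix S, because F is invertible and inversion reverses the
  Loewner order of positive definite matrices. Hence, if d is optimal for (F), changing d at a single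
  time n and pulling the comparison of the final covariances back to time n shows that the
  information matrix of d at time n is the Loewner maximum over all selections at that time. By
  monotonicity d then minimizes every covariance simultaneously, and a feasible family is optimal for
  any of the three problems exactly when it has the same information matrices as d: a positive
  semidefinite matrix with trace 0 vanishes, which settles (A) and (T).
*)
theory Submission
  imports Defs "Jordan_Normal_Form.Determinant"
begin

section \<open>Semidefinite matrices and the Loewner order\<close>

lemma symmetric_bilinear:
  assumes "A \<in> carrier_mat n n" "A\<^sup>T = A" "x \<in> carrier_vec n" "y \<in> carrier_vec n"
  shows "x \<bullet> (A *\<^sub>v y) = y \<bullet> (A *\<^sub>v (x :: real vec))"
  using transpose_vec_mult_scalar[OF assms(1,4,3)] assms
    comm_scalar_prod[of "A *\<^sub>v x" n y] by (metis mult_mat_vec_carrier)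

lemma pos_semidef_iff:
  assumes "A \<in> carrier_mat n n"
  shows "pos_semidef A \<longleftrightarrow> A\<^sup>T = A \<and> (\<forall>v \<in> carrier_vec n. v \<bullet> (A *\<^sub>v v) \<ge> 0)"
  using assms unfolding pos_semidef_def by auto

lemma pos_def_iff:
  assumes "A \<in> carrier_mat n n"
  shows "pos_def A \<longleftrightarrow>
    A\<^sup>T = A \<and> (\<forall>v \<in> carrier_vec n. v \<noteq> 0\<^sub>v n \<longrightarrow> v \<bullet> (A *\<^sub>v v) > 0)"
  using assms unfolding pos_def_def by auto

lemma pos_def_imp_pos_semidef:
  assumes A: "A \<in> carrier_mat n n" and "pos_def A"
  shows "pos_semidef A"
  unfolding pos_semidef_iff[OF A]
proof (intro conjI ballI)
  fix v :: "real vec" assume v: "v \<in> carrier_vec n"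
  show "v \<bullet> (A *\<^sub>v v) \<ge> 0"
  proof (cases "v = 0\<^sub>v n")
    case True
    then show ?thesis using A by (simp add: scalar_prod_left_zero)
  qed (use assms v in \<open>auto simp: pos_def_iff[OF A] less_imp_le\<close>)
qed (use assms in \<open>auto simp: pos_def_def\<close>)

lemma quadratic_form_add:
  fixes A B :: "real mat"
  assumes "A \<in> carrier_mat n n" "B \<in> carrier_mat n n" "v \<in> carrier_vec n"
  shows "v \<bullet> ((A + B) *\<^sub>v v) = v \<bullet> (A *\<^sub>v v) + v \<bullet> (B *\<^sub>v v)"
  using assms by (simp add: add_mult_distrib_mat_vec[of _ n n] scalar_prod_add_distrib[of _ n])

lemma quadratic_form_minus:
  fixes A B :: "real mat"
  assumes "A \<in> carrier_mat n n" "B \<in> carrier_mat n n" "v \<in> carrier_vec n"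
  shows "v \<bullet> ((A - B) *\<^sub>v v) = v \<bullet> (A *\<^sub>v v) - v \<bullet> (B *\<^sub>v v)"
  using assms by (simp add: minus_mult_distrib_mat_vec[of _ n n] scalar_prod_minus_distrib[of _ n])

lemma quadratic_form_congruence:
  fixes A B :: "real mat"
  assumes A: "A \<in> carrier_mat m m" and B: "B \<in> carrier_mat m n" and v: "v \<in> carrier_vec n"
  shows "v \<bullet> ((B\<^sup>T * A * B) *\<^sub>v v) = (B *\<^sub>v v) \<bullet> (A *\<^sub>v (B *\<^sub>v v))"
proof -
  let ?w = "A *\<^sub>v (B *\<^sub>v v)"
  have Bv: "B *\<^sub>v v \<in> carrier_vec m" using B v by simp
  have w: "?w \<in> carrier_vec m" using A Bv by simp
  have Bt: "B\<^sup>T \<in> carrier_mat n m" using B by simp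
  have "(B\<^sup>T * A * B) *\<^sub>v v = (B\<^sup>T * A) *\<^sub>v (B *\<^sub>v v)"
    using A B Bt v by (intro assoc_mult_mat_vec[of _ n m _ n]) auto
  also have "\<dots> = B\<^sup>T *\<^sub>v ?w"
    using A Bt Bv by (intro assoc_mult_mat_vec[of _ n m _ m]) auto
  finally have "v \<bullet> ((B\<^sup>T * A * B) *\<^sub>v v) = (B\<^sup>T *\<^sub>v ?w) \<bullet> v"
    using Bt w v by (simp add: comm_scalar_prod[of v n])
  also have "\<dots> = ?w \<bullet> (B *\<^sub>v v)"
    by (rule transpose_vec_mult_scalar[OF B v w])
  finally show ?thesis using comm_scalar_prod[OF Bv w] by simp
qed

lemma transpose_congruence:
  fixes A B :: "real mat"
  assumes A: "A \<in> carrier_mat m m" "A\<^sup>T = A" and B: "B \<in> carrier_mat m n"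
  shows "(B\<^sup>T * A * B)\<^sup>T = B\<^sup>T * A * B"
proof -
  have Bt: "B\<^sup>T \<in> carrier_mat n m" using B by simp
  have "(B\<^sup>T * A * B)\<^sup>T = B\<^sup>T * (B\<^sup>T * A)\<^sup>T"
    using A B Bt by (intro transpose_mult[of _ n m _ n]) auto
  also have "(B\<^sup>T * A)\<^sup>T = A * B"
    using A by (subst transpose_mult[OF Bt A(1)]) simp
  finally show ?thesis using assoc_mult_mat[OF Bt A(1) B] by simp
qed

lemma pos_semidef_congruence:
  assumes A: "A \<in> carrier_mat m m" "pos_semidef A" and B: "B \<in> carrier_mat m n"
  shows "pos_semidef (B\<^sup>T * A * B)"
proof -
  have C: "B\<^sup>T * A * B \<in> carrier_mat n n" using A B by simp
  show ?thesis
    using A(2) transpose_congruence[OF A(1) _ B] mult_mat_vec_carrier[OF B]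
    unfolding pos_semidef_iff[OF C] pos_semidef_iff[OF A(1)]
    by (auto simp: quadratic_form_congruence[OF A(1) B] simp del: assoc_mult_mat)
qed

lemma pos_semidef_congruence':
  assumes A: "A \<in> carrier_mat n n" "pos_semidef A" and B: "B \<in> carrier_mat m n"
  shows "pos_semidef (B * A * B\<^sup>T)"
  using pos_semidef_congruence[OF A, of "B\<^sup>T" m] B by simp

lemma pos_semidef_add_pos_def:
  assumes A: "A \<in> carrier_mat n n" "pos_semidef A" and B: "B \<in> carrier_mat n n" "pos_def B"
  shows "pos_def (A + B)"
proof -
  have C: "A + B \<in> carrier_mat n n" using A B by simp
  show ?thesis
    using A B unfolding pos_def_iff[OF C] pos_def_iff[OF B(1)] pos_semidef_iff[OF A(1)]
    by (auto simp: transpose_add[of _ n n] quadratic_form_add intro!: add_nonneg_pos)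
qed

section \<open>The Loewner order and the trace\<close>

lemma loewner_ge_iff:
  assumes A: "A \<in> carrier_mat n n" "A\<^sup>T = A" and B: "B \<in> carrier_mat n n" "B\<^sup>T = B"
  shows "A \<succeq>\<^sub>L B \<longleftrightarrow> (\<forall>v \<in> carrier_vec n. v \<bullet> (A *\<^sub>v v) \<ge> v \<bullet> (B *\<^sub>v v))"
proof -
  have C: "A - B \<in> carrier_mat n n" using minus_carrier_mat B by blast
  show ?thesis
    using A B unfolding loewner_ge_def pos_semidef_iff[OF C]
    by (auto simp: transpose_minus[of _ n n] quadratic_form_minus)
qed

text \<open>Polarization: as the diagonal vanishes, the form takes the values 2 A_ij and -2 A_ij at
  e_i + e_j and e_i - e_j. Both are nonnegative, so A_ij = 0.\<close>

lemma quadratic_form_zero: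
  assumes A: "A \<in> carrier_mat n n" "A\<^sup>T = A"
    and zero: "\<And>i. i < n \<Longrightarrow> A $$ (i, i) = 0"
    and nonneg: "\<And>v. v \<in> carrier_vec n \<Longrightarrow> v \<bullet> (A *\<^sub>v v) \<ge> (0 :: real)"
  shows "A = 0\<^sub>m n n"
proof (rule eq_matI)
  fix i j assume "i < dim_row (0\<^sub>m n n :: real mat)" "j < dim_col (0\<^sub>m n n :: real mat)"
  then have ij: "i < n" "j < n" by auto
  have sym: "A $$ (j, i) = A $$ (i, j)"
    using A ij by (metis carrier_matD index_transpose_mat(1))
  let ?e = "unit_vec n :: nat \<Rightarrow> real vec"
  have e: "?e a \<bullet> (A *\<^sub>v ?e b) = A $$ (a, b)" if "a < n" "b < n" for a b
    using that A by simp
  have p: "?e i + ?e j \<in> carrier_vec n" and q: "?e i - ?e j \<in> carrier_vec n" by auto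
  have Ae: "A *\<^sub>v ?e a \<in> carrier_vec n" for a
    using A by (metis mult_mat_vec_carrier unit_vec_carrier)
  have "(?e i + ?e j) \<bullet> (A *\<^sub>v (?e i + ?e j)) = 2 * A $$ (i, j)"
    using ij e sym Ae zero
    by (simp add: mult_add_distrib_mat_vec[OF A(1)] scalar_prod_add_distrib[of _ n]
        add_scalar_prod_distrib[of _ n] del: scalar_prod_left_unit)
  moreover have "(?e i - ?e j) \<bullet> (A *\<^sub>v (?e i - ?e j)) = - 2 * A $$ (i, j)"
    using ij e sym Ae zero
    by (simp add: mult_minus_distrib_mat_vec[OF A(1)] scalar_prod_minus_distrib[of _ n]
        minus_scalar_prod_distrib[of _ n] del: scalar_prod_left_unit)
  ultimately show "A $$ (i, j) = 0\<^sub>m n n $$ (i, j)"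
    using nonneg[OF p] nonneg[OF q] ij by simp
qed (use A in auto)

lemma mat_trace_minus:
  assumes "A \<in> carrier_mat n n" "B \<in> carrier_mat n n"
  shows "mat_trace (A - B) = mat_trace A - mat_trace B"
  using assms by (auto simp: mat_trace_def sum_subtractf)

lemma pos_semidef_diag_nonneg:
  assumes A: "A \<in> carrier_mat n n" "pos_semidef A" and i: "i < n"
  shows "A $$ (i, i) \<ge> 0"
proof -
  have "unit_vec n i \<bullet> (A *\<^sub>v unit_vec n i) \<ge> 0"
    using A unfolding pos_semidef_iff[OF A(1)] by auto
  then show ?thesis using A i by simp
qed

lemma loewner_ge_trace:
  assumes A: "A \<in> carrier_mat n n" and B: "B \<in> carrier_mat n n" and ge: "A \<succeq>\<^sub>L B"
  shows "mat_trace A \<ge> mat_trace B"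
proof -
  have C: "A - B \<in> carrier_mat n n" using minus_carrier_mat B by blast
  have "mat_trace (A - B) \<ge> 0"
    using pos_semidef_diag_nonneg[OF C ge[unfolded loewner_ge_def]] C
    by (auto simp: mat_trace_def simp del: index_minus_mat intro!: sum_nonneg)
  then show ?thesis using A B by (simp add: mat_trace_minus)
qed

text \<open>The difference is semidefinite with trace 0, so its nonnegative diagonal entries all
  vanish and \<open>quadratic_form_zero\<close> applies. This turns scalar comparisons into equality
  of matrices, both for (A) and for (T).\<close>

lemma loewner_ge_trace_eq:
  assumes A: "A \<in> carrier_mat n n" and B: "B \<in> carrier_mat n n" and ge: "A \<succeq>\<^sub>L B"
    and tr: "mat_trace A \<le> mat_trace B"
  shows "A = B"
proof -
  have C: "A - B \<in> carrier_mat n n" using minus_carrier_mat B by blast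
  have psd: "pos_semidef (A - B)" using ge by (simp add: loewner_ge_def)
  have nonneg: "\<forall>i\<in>{..<n}. 0 \<le> (A - B) $$ (i, i)"
    using pos_semidef_diag_nonneg[OF C psd] by auto
  have "mat_trace (A - B) = 0"
    using loewner_ge_trace[OF A B ge] tr A B by (simp add: mat_trace_minus)
  then have "(\<Sum>i<n. (A - B) $$ (i, i)) = 0"
    using C by (metis carrier_matD(1) mat_trace_def)
  then have "\<forall>i\<in>{..<n}. (A - B) $$ (i, i) = 0"
    using nonneg by (subst (asm) sum_nonneg_eq_0_iff) auto
  then have "A - B = 0\<^sub>m n n"
    using psd unfolding pos_semidef_iff[OF C] by (intro quadratic_form_zero[OF C]) auto
  then have D: "(A - B) $$ (i, j) = 0" if "i < n" "j < n" for i j using that by simp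
  show ?thesis
    by (rule eq_matI) (use A B D in auto)
qed

lemma loewner_ge_refl:
  assumes "A \<in> carrier_mat n n"
  shows "A \<succeq>\<^sub>L A"
proof -
  have A: "A - A = 0\<^sub>m n n" using assms by (rule minus_r_inv_mat)
  have "v \<bullet> (0\<^sub>m n n *\<^sub>v v) = (0 :: real)" if "v \<in> carrier_vec n" for v
    using quadratic_form_minus[OF assms assms that] by (simp add: A)
  then show ?thesis unfolding loewner_ge_def A pos_semidef_def by simp
qed

text \<open>The two comparisons give opposite inequalities between the traces, so
  \<open>loewner_ge_trace_eq\<close> applies.\<close>

lemma loewner_ge_antisym:
  assumes "A \<in> carrier_mat n n" "B \<in> carrier_mat n n" "A \<succeq>\<^sub>L B" "B \<succeq>\<^sub>L A"
  shows "A = B"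
  using assms loewner_ge_trace loewner_ge_trace_eq by blast

lemma loewner_ge_trans:
  assumes A: "A \<in> carrier_mat n n" and B: "B \<in> carrier_mat n n" and C: "C \<in> carrier_mat n n"
    and AB: "A \<succeq>\<^sub>L B" and BC: "B \<succeq>\<^sub>L C"
  shows "A \<succeq>\<^sub>L C"
proof -
  have c: "A - B \<in> carrier_mat n n" "B - C \<in> carrier_mat n n" "A - C \<in> carrier_mat n n"
    using A B C by auto
  have eq: "A - C = (A - B) + (B - C)"
    by (rule eq_matI) (use A B C in auto)
  show ?thesis
    using AB BC unfolding loewner_ge_def eq pos_semidef_iff[OF c(1)] pos_semidef_iff[OF c(2)]
      pos_semidef_iff[OF add_carrier_mat[OF c(2)]]
    using c by (auto simp: transpose_add[of _ n n] quadratic_form_add simp del: minus_carrier_mat)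
qed

lemma loewner_ge_add_right_iff:
  assumes "A \<in> carrier_mat n n" "B \<in> carrier_mat n n" "C \<in> carrier_mat n n"
  shows "A + C \<succeq>\<^sub>L B + C \<longleftrightarrow> A \<succeq>\<^sub>L B"
proof -
  have "(A + C) - (B + C) = A - B"
    by (rule eq_matI) (use assms in auto)
  then show ?thesis by (simp add: loewner_ge_def)
qed

lemma loewner_ge_add_left_iff:
  assumes "A \<in> carrier_mat n n" "B \<in> carrier_mat n n" "C \<in> carrier_mat n n"
  shows "C + A \<succeq>\<^sub>L C + B \<longleftrightarrow> A \<succeq>\<^sub>L B"
  using loewner_ge_add_right_iff[OF assms] assms comm_add_mat by metis

lemma loewner_ge_add:
  assumes "A \<in> carrier_mat n n" "B \<in> carrier_mat n n" "C \<in> carrier_mat n n" "D \<in> carrier_mat n n"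
    and "A \<succeq>\<^sub>L B" "C \<succeq>\<^sub>L D"
  shows "A + C \<succeq>\<^sub>L B + D"
proof -
  have "A + C \<succeq>\<^sub>L B + C" "B + C \<succeq>\<^sub>L B + D"
    using assms by (simp_all add: loewner_ge_add_right_iff loewner_ge_add_left_iff)
  then show ?thesis
    by (rule loewner_ge_trans[rotated 3, where n = n]) (use assms in simp_all)
qed

text \<open>Congruence preserves semidefiniteness. Applied with \<open>F\<close> it gives one
  direction, with the inverse \<open>G\<close> of \<open>F\<close> the other.\<close>

lemma loewner_ge_congruence_iff:
  assumes A: "A \<in> carrier_mat n n" and B: "B \<in> carrier_mat n n"
    and F: "F \<in> carrier_mat n n" "invertible_mat F"
  shows "F * A * F\<^sup>T \<succeq>\<^sub>L F * B * F\<^sup>T \<longleftrightarrow> A \<succeq>\<^sub>L B"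
proof -
  obtain G where FG: "F * G = 1\<^sub>m n" and GF: "G * F = 1\<^sub>m (dim_row G)"
    using F unfolding invertible_mat_def inverts_mat_def by auto
  \<comment> \<open>The size of \<open>G\<close> is read off from the column counts of the two
    products.\<close>
  have G: "G \<in> carrier_mat n n"
    using arg_cong[OF FG, of dim_col] arg_cong[OF GF, of dim_col] F by auto
  have Ft: "F\<^sup>T \<in> carrier_mat n n" and Gt: "G\<^sup>T \<in> carrier_mat n n" using F G by auto
  have C: "A - B \<in> carrier_mat n n" using minus_carrier_mat B by blast
  have eq: "F * A * F\<^sup>T - F * B * F\<^sup>T = F * (A - B) * F\<^sup>T"
    using A B F Ft
    by (simp add: mult_minus_distrib_mat[of _ n n _ n] minus_mult_distrib_mat[of _ n n _ _ n])
  have inv: "G * (F * D * F\<^sup>T) * G\<^sup>T = D" if D: "D \<in> carrier_mat n n" for D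
  proof -
    have "G * (F * D * F\<^sup>T) * G\<^sup>T = (G * F) * D * (F\<^sup>T * G\<^sup>T)"
      using D F G Ft Gt by (simp add: assoc_mult_mat[of _ n n _ n _ n])
    also have "F\<^sup>T * G\<^sup>T = 1\<^sub>m n"
      using transpose_mult[OF G F(1)] GF G by simp
    finally show ?thesis using GF G D by simp
  qed
  have FCF: "F * (A - B) * F\<^sup>T \<in> carrier_mat n n" using F Ft C by simp
  show ?thesis
    unfolding loewner_ge_def eq
    using pos_semidef_congruence'[OF C _ F(1)] pos_semidef_congruence'[OF FCF _ G] inv[OF C] by auto
qed

section \<open>Inverses of positive definite matrices\<close>

text \<open>The inverse exists because the form would vanish at a nonzero kernel vector. It is
  symmetric because its transpose is a left inverse of the symmetric matrix \<open>A\<close>. Its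
  form at v = A w equals the form of \<open>A\<close> at w, which gives positivity.\<close>

lemma pos_def_mat_inv:
  assumes A: "A \<in> carrier_mat n n" "pos_def A"
  shows "mat_inv A \<in> carrier_mat n n" "A * mat_inv A = 1\<^sub>m n" "mat_inv A * A = 1\<^sub>m n"
    "pos_def (mat_inv A)"
proof -
  have "det A \<noteq> 0"
    using A unfolding det_0_iff_vec_prod_zero_field[OF A(1)] pos_def_iff[OF A(1)] by force
  then have "mat_inverse A \<noteq> None"
    using mat_inverse(1)[OF A(1), of "()"] det_non_zero_imp_unit[OF A(1), of "()"] by blast
  then have "mat_inverse A = Some (mat_inv A)"
    by (auto simp: mat_inv_def)
  from mat_inverse(2)[OF A(1) this]
  show B: "mat_inv A \<in> carrier_mat n n" "A * mat_inv A = 1\<^sub>m n" "mat_inv A * A = 1\<^sub>m n"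
    by auto
  let ?B = "mat_inv A"
  have At: "A\<^sup>T = A" using A by (simp add: pos_def_def)
  have Bt: "?B\<^sup>T \<in> carrier_mat n n" using B by simp
  have "?B\<^sup>T * A = 1\<^sub>m n"
    using transpose_mult[OF A(1) B(1)] B(2) At by simp
  then have "?B\<^sup>T * (A * ?B) = ?B"
    using assoc_mult_mat[OF Bt A(1) B(1)] B by simp
  then have sym: "?B\<^sup>T = ?B" using B Bt by simp
  show "pos_def ?B"
    unfolding pos_def_iff[OF B(1)]
  proof (intro conjI ballI impI sym)
    fix v :: "real vec" assume v: "v \<in> carrier_vec n" "v \<noteq> 0\<^sub>v n"
    let ?w = "?B *\<^sub>v v"
    have w: "?w \<in> carrier_vec n" using B v by simp
    have Aw: "A *\<^sub>v ?w = v"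
      using assoc_mult_mat_vec[OF A(1) B(1) v(1)] B v by simp
    moreover have "A *\<^sub>v 0\<^sub>v n = 0\<^sub>v n" using A by (intro eq_vecI) auto
    ultimately have "?w \<noteq> 0\<^sub>v n" using v by metis
    then have "?w \<bullet> (A *\<^sub>v ?w) > 0" using A w by (simp add: pos_def_iff[OF A(1)])
    then show "v \<bullet> ?w > 0" using Aw comm_scalar_prod[OF v(1) w] by simp
  qed
qed

lemma mat_inv_mat_inv:
  assumes A: "A \<in> carrier_mat n n" "pos_def A"
  shows "mat_inv (mat_inv A) = A"
proof -
  note B = pos_def_mat_inv[OF A]
  note C = pos_def_mat_inv[OF B(1,4)]
  have "A * mat_inv A * mat_inv (mat_inv A) = A * (mat_inv A * mat_inv (mat_inv A))"
    using A B C by (intro assoc_mult_mat) auto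
  then show ?thesis using A B C by simp
qed

text \<open>With x = A^-1 v and y = B^-1 v, expanding 0 <= (x - y)' B (x - y) gives 2 x'v <= x'Bx +
  y'v, and x'Bx <= x'Ax = x'v by hypothesis. Hence x'v <= y'v, which compares the two inverse forms
  at v.\<close>

lemma mat_inv_antimono:
  assumes A: "A \<in> carrier_mat n n" "pos_def A" and B: "B \<in> carrier_mat n n" "pos_def B"
    and ge: "A \<succeq>\<^sub>L B"
  shows "mat_inv B \<succeq>\<^sub>L mat_inv A"
proof -
  note A' = pos_def_mat_inv[OF A] and B' = pos_def_mat_inv[OF B]
  have sym: "A\<^sup>T = A" "B\<^sup>T = B" "(mat_inv A)\<^sup>T = mat_inv A" "(mat_inv B)\<^sup>T = mat_inv B"
    using A B A' B' by (auto simp: pos_def_def)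
  have "v \<bullet> (mat_inv B *\<^sub>v v) \<ge> v \<bullet> (mat_inv A *\<^sub>v v)" if v: "v \<in> carrier_vec n" for v
  proof -
    define x where "x = mat_inv A *\<^sub>v v"
    define y where "y = mat_inv B *\<^sub>v v"
    have x: "x \<in> carrier_vec n" and y: "y \<in> carrier_vec n"
      using A' B' v by (auto simp: x_def y_def)
    have Ax: "A *\<^sub>v x = v"
      using assoc_mult_mat_vec[OF A(1) A'(1) v] A' v by (simp add: x_def)
    have By: "B *\<^sub>v y = v"
      using assoc_mult_mat_vec[OF B(1) B'(1) v] B' v by (simp add: y_def)
    have Bx: "B *\<^sub>v x \<in> carrier_vec n" using B x by simp
    have "0 \<le> (x - y) \<bullet> (B *\<^sub>v (x - y))"
      using pos_def_imp_pos_semidef[OF B] x y by (simp add: pos_semidef_iff[OF B(1)])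
    also have "\<dots> = x \<bullet> (B *\<^sub>v x) - x \<bullet> v - y \<bullet> (B *\<^sub>v x) + y \<bullet> v"
      using x y v Bx By
      by (simp add: mult_minus_distrib_mat_vec[OF B(1)] scalar_prod_minus_distrib[of _ n]
          minus_scalar_prod_distrib[of _ n])
    also have "y \<bullet> (B *\<^sub>v x) = x \<bullet> v"
      using symmetric_bilinear[OF B(1) sym(2) y x] By by simp
    also have "x \<bullet> (B *\<^sub>v x) \<le> x \<bullet> v"
      using ge x unfolding loewner_ge_iff[OF A(1) sym(1) B(1) sym(2)] by (metis Ax)
    finally have "x \<bullet> v \<le> y \<bullet> v" by simp
    then show ?thesis
      using comm_scalar_prod[OF v x] comm_scalar_prod[OF v y] by (simp add: x_def y_def)
  qed
  then show ?thesis
    by (simp add: loewner_ge_iff[OF B'(1) sym(4) A'(1) sym(3)])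
qed

text \<open>Inversion is an involution on positive definite matrices, so antitonicity applied to the
  inverses yields the converse. The equivalence is what later allows comparisons to be pulled back
  through a step.\<close>

lemma mat_inv_loewner_ge_iff:
  assumes "A \<in> carrier_mat n n" "pos_def A" "B \<in> carrier_mat n n" "pos_def B"
  shows "mat_inv A \<succeq>\<^sub>L mat_inv B \<longleftrightarrow> B \<succeq>\<^sub>L A"
  using mat_inv_antimono[of B n A] mat_inv_antimono[of "mat_inv A" n "mat_inv B"]
    assms pos_def_mat_inv mat_inv_mat_inv by metis

section \<open>The information matrix\<close>

text \<open>Symmetry of the products lets them be swapped under transposition, so A Y = A X and Y A
  = X A; then X = Y A X = Y A Y = Y. As \<open>pseudoinverse\<close> is a definite description, this
  is what identifies it with an explicit candidate.\<close>

lemma is_pseudoinverse_unique: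
  assumes X: "is_pseudoinverse A X" and Y: "is_pseudoinverse A Y"
  shows "X = Y"
proof -
  obtain m n where A: "A \<in> carrier_mat m n" by auto
  have c: "X \<in> carrier_mat n m" "Y \<in> carrier_mat n m"
    using X Y A by (auto simp: is_pseudoinverse_def)
  have X': "A * X * A = A" "X * A * X = X" "(A * X)\<^sup>T = A * X" "(X * A)\<^sup>T = X * A"
    and Y': "A * Y * A = A" "Y * A * Y = Y" "(A * Y)\<^sup>T = A * Y" "(Y * A)\<^sup>T = Y * A"
    using X Y by (auto simp: is_pseudoinverse_def)
  have AX: "A * X \<in> carrier_mat m m" "A * Y \<in> carrier_mat m m"
    and XA: "X * A \<in> carrier_mat n n" "Y * A \<in> carrier_mat n n"
    using A c by auto
  have "A * Y = (A * X) * (A * Y)"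
    using assoc_mult_mat[OF AX(1) A c(2)] X' by simp
  also have "\<dots> = ((A * Y) * (A * X))\<^sup>T"
    using transpose_mult[OF AX(2,1)] X' Y' by simp
  also have "(A * Y) * (A * X) = A * X"
    using assoc_mult_mat[OF AX(2) A c(1)] Y' by simp
  finally have 1: "A * Y = A * X" using X' by simp
  have "Y * A = (Y * A) * (X * A)"
    using assoc_mult_mat[OF c(2) A XA(1)] assoc_mult_mat[OF A c(1) A] X' by simp
  also have "\<dots> = ((X * A) * (Y * A))\<^sup>T"
    using transpose_mult[OF XA] X' Y' by simp
  also have "(X * A) * (Y * A) = X * A"
    using assoc_mult_mat[OF c(1) A XA(2)] assoc_mult_mat[OF A c(2) A] Y' by simp
  finally have 2: "Y * A = X * A" using X' by simp
  have "X = Y * A * X" using X' 2 by simp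
  also have "\<dots> = Y * A * Y"
    using assoc_mult_mat[OF c(2) A c(1)] assoc_mult_mat[OF c(2) A c(2)] 1 by simp
  finally show ?thesis using Y' by simp
qed

lemma pseudoinverse_eqI:
  "is_pseudoinverse A X \<Longrightarrow> pseudoinverse A = X"
  unfolding pseudoinverse_def using is_pseudoinverse_unique by blast

lemma pos_def_one: "pos_def (1\<^sub>m n)"
proof -
  have "v \<bullet> v > 0" if v: "v \<in> carrier_vec n" "v \<noteq> 0\<^sub>v n" for v :: "real vec"
  proof -
    have "\<exists>i<n. v $ i \<noteq> 0"
    proof (rule ccontr)
      assume "\<not> ?thesis"
      then have "v = 0\<^sub>v n" using v by (intro eq_vecI) auto
      then show False using v by simp
    qed
    then obtain i where "i < n" "v $ i \<noteq> 0" by auto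
    then show ?thesis
      unfolding scalar_prod_def using v
      by (intro sum_pos2[of _ i]) (auto simp: zero_less_mult_iff neq_iff)
  qed
  then show ?thesis by (auto simp: pos_def_iff[of _ n])
qed

text \<open>
  The matrix \<open>K = D R D + (1 - D)\<close> is positive definite and commutes with the orthogonal
  projection \<open>D\<close>; the pseudoinverse of \<open>D R D\<close> is \<open>D K\<^sup>-\<^sup>1 = D K\<^sup>-\<^sup>1 D\<close>.
\<close>

lemma pseudoinverse_compression:
  assumes R: "R \<in> carrier_mat n n" "pos_def R"
    and D: "D \<in> carrier_mat n n" "D\<^sup>T = D" "D * D = D"
  shows "pseudoinverse (D * R * D) \<in> carrier_mat n n" "pos_semidef (pseudoinverse (D * R * D))"
proof -
  define A where "A = D * R * D"
  define E where "E = 1\<^sub>m n - D"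
  define K where "K = A + E"
  have c: "A \<in> carrier_mat n n" "E \<in> carrier_mat n n" "K \<in> carrier_mat n n"
    using R D by (auto simp: A_def E_def K_def)
  note assoc = assoc_mult_mat[of _ n n _ n _ n]
  have ED: "E * D = 0\<^sub>m n n" and DE: "D * E = 0\<^sub>m n n"
    using D by (simp_all add: E_def minus_mult_distrib_mat[of _ n n _ _ n]
        mult_minus_distrib_mat[of _ n n _ n])
  have EE: "E * E = E"
    using c D DE by (subst (1) E_def) (auto simp: minus_mult_distrib_mat[of _ n n _ _ n] intro!: eq_matI)
  have Et: "E\<^sup>T = E"
    using D by (simp add: E_def transpose_minus[of _ n n])
  have At: "A\<^sup>T = A"
    using transpose_congruence[OF R(1) _ D(1)] R D by (simp add: A_def pos_def_def)
  have DR: "D * R \<in> carrier_mat n n" using R D by simp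
  have AD: "A * D = A"
    using assoc_mult_mat[OF DR D(1) D(1)] D(3) by (simp add: A_def)
  have DA: "D * A = A"
    using R D assoc_mult_mat[OF D(1) DR D(1)] assoc_mult_mat[OF D(1) D(1) R(1)] by (simp add: A_def)
  have KD: "K * D = A" and DK: "D * K = A"
    using c D AD DA ED DE
    by (simp_all add: K_def add_mult_distrib_mat[of _ n n _ _ n] mult_add_distrib_mat[of _ n n _ n])
  have "pos_def K"
    unfolding pos_def_iff[OF c(3)]
  proof (intro conjI ballI impI)
    show "K\<^sup>T = K" using c At Et by (simp add: K_def transpose_add[of _ n n])
    fix v :: "real vec" assume v: "v \<in> carrier_vec n" "v \<noteq> 0\<^sub>v n"
    have Dv: "D *\<^sub>v v \<in> carrier_vec n" and Ev: "E *\<^sub>v v \<in> carrier_vec n" using D c v by auto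
    \<comment> \<open>Written as a congruence of the identity, \<open>E\<close> has as its form at
      \<open>v\<close> the squared length of \<open>E v\<close>.\<close>
    have "E = E\<^sup>T * 1\<^sub>m n * E" using c Et EE by simp
    then have E: "v \<bullet> (E *\<^sub>v v) = (E *\<^sub>v v) \<bullet> (1\<^sub>m n *\<^sub>v (E *\<^sub>v v))"
      using quadratic_form_congruence[OF one_carrier_mat c(2) v(1)] by simp
    have A: "v \<bullet> (A *\<^sub>v v) = (D *\<^sub>v v) \<bullet> (R *\<^sub>v (D *\<^sub>v v))"
      using quadratic_form_congruence[OF R(1) D(1) v(1)] D by (simp add: A_def)
    have E0: "v \<bullet> (E *\<^sub>v v) \<ge> 0"
      using pos_def_imp_pos_semidef[OF one_carrier_mat pos_def_one[of n]] Ev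
      unfolding E pos_semidef_iff[OF one_carrier_mat] by blast
    have A0: "v \<bullet> (A *\<^sub>v v) \<ge> 0"
      using pos_def_imp_pos_semidef[OF R] Dv unfolding A pos_semidef_iff[OF R(1)] by blast
    \<comment> \<open>The two forms cannot vanish together: either \<open>D v\<close> is nonzero and
      \<open>R\<close> is positive there, or \<open>E v = v\<close> is nonzero.\<close>
    have "v \<bullet> (A *\<^sub>v v) > 0 \<or> v \<bullet> (E *\<^sub>v v) > 0"
    proof (cases "D *\<^sub>v v = 0\<^sub>v n")
      case True
      then have "E *\<^sub>v v = v"
        using D v by (simp add: E_def minus_mult_distrib_mat_vec[of _ n n])
      then show ?thesis
        using pos_def_one[of n] v unfolding E pos_def_iff[OF one_carrier_mat] by auto
    next
      case False
      then show ?thesis using R Dv unfolding A pos_def_iff[OF R(1)] by auto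
    qed
    then show "v \<bullet> (K *\<^sub>v v) > 0"
      using A0 E0 quadratic_form_add[OF c(1,2) v(1)] by (auto simp: K_def)
  qed
  define J where "J = mat_inv K"
  note J = pos_def_mat_inv[OF c(3) \<open>pos_def K\<close>, folded J_def]
  \<comment> \<open>Both \<open>D K\<close> and \<open>K D\<close> equal \<open>A\<close>;
    multiplying by \<open>J\<close> on both sides transfers the commutation from \<open>K\<close> to
    \<open>J\<close>.\<close>
  have "J * (D * K) * J = J * D * (K * J)" "J * (K * D) * J = J * K * (D * J)"
    using J(1) c D(1) by (simp_all add: assoc)
  then have JD: "J * D = D * J" using J D by (simp add: DK KD)
  define X where "X = D * J"
  have X: "X \<in> carrier_mat n n" using D J by (simp add: X_def)
  have "A * X = A * D * J" using c D(1) J(1) by (simp add: X_def)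
  also have "\<dots> = D * K * J" by (simp only: AD DK)
  also have "\<dots> = D * (K * J)" using c D(1) J(1) by (simp add: assoc)
  finally have AX: "A * X = D" using J D by simp
  have "X * A = D * J * (K * D)" by (simp only: X_def KD)
  also have "\<dots> = D * (J * K) * D" using c D(1) J(1) by (simp add: assoc)
  finally have XA: "X * A = D" using J D by simp
  \<comment> \<open>Since \<open>A X\<close> and \<open>X A\<close> are both the projection
    \<open>D\<close>, the Penrose equations reduce to \<open>D A = A\<close>, \<open>D X = X\<close>
    and the symmetry of \<open>D\<close>.\<close>
  have "is_pseudoinverse A X"
    unfolding is_pseudoinverse_def AX XA
  proof (intro conjI)
    show "D * X = X" using assoc_mult_mat[OF D(1) D(1) J(1)] D by (simp add: X_def)
  qed (use X c D DA in auto)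
  then have p: "pseudoinverse (D * R * D) = X"
    using pseudoinverse_eqI by (simp add: A_def)
  \<comment> \<open>Idempotence and commutation give D J = D D J = D J D, a congruence of the
    positive definite \<open>J\<close>.\<close>
  have "X = D\<^sup>T * J * D"
    using assoc_mult_mat[OF D(1) J(1) D(1)] assoc_mult_mat[OF D(1) D(1) J(1)] JD D by (simp add: X_def)
  then show "pseudoinverse (D * R * D) \<in> carrier_mat n n" "pos_semidef (pseudoinverse (D * R * D))"
    unfolding p using pos_semidef_congruence[OF J(1) pos_def_imp_pos_semidef[OF J(1,4)] D(1)] X by auto
qed

section \<open>Block structure of the selected matrices\<close>

lemma block_index_mem:
  assumes "p < length (block_index d l)"
  obtains i a where "block_index d l ! p = (i, a)" "i \<in> {1..l}" "a < d i"
proof -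
  have "block_index d l ! p \<in> set (block_index d l)" using assms by simp
  then show ?thesis using that by (auto simp: block_index_def)
qed

lemma length_block_index_1: "length (block_index (\<lambda>_. r) 1) = r"
  by (simp add: block_index_def)

text \<open>The diagonal matrix repeats \<open>g i\<close> along the rows of block \<open>i\<close>.
  This brings the noise covariance of the selected sensors into the form treated in
  \<open>pseudoinverse_compression\<close>.\<close>

lemma selected_R_eq:
  assumes R: "\<And>i s. i \<in> {1..L} \<Longrightarrow> s \<in> {1..L} \<Longrightarrow> R i s \<in> carrier_mat (d i) (d s)"
  defines "D g \<equiv> mat_diag (length (block_index d L)) (\<lambda>p. g (fst (block_index d L ! p)))"
  shows "selected_R L d R g = D g * block_matrix d L d L R * D g"
proof -
  let ?n = "length (block_index d L)"
  have B: "block_matrix d L d L R \<in> carrier_mat ?n ?n" by (simp add: block_matrix_def)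
  have "D g * block_matrix d L d L R * D g =
      mat ?n ?n (\<lambda>(p, q). g (fst (block_index d L ! p)) * block_matrix d L d L R $$ (p, q) *
        g (fst (block_index d L ! q)))"
    unfolding D_def mat_diag_mult_left[OF B] by (subst mat_diag_mult_right[of _ ?n]) auto
  also have "\<dots> = selected_R L d R g"
  proof (rule eq_matI)
    fix p q assume "p < dim_row (selected_R L d R g)" "q < dim_col (selected_R L d R g)"
    then have pq: "p < ?n" "q < ?n" by (auto simp: selected_R_def block_matrix_def)
    obtain i a where ia: "block_index d L ! p = (i, a)" "i \<in> {1..L}" "a < d i"
      using block_index_mem[OF pq(1)] by blast
    obtain s b where sb: "block_index d L ! q = (s, b)" "s \<in> {1..L}" "b < d s"
      using block_index_mem[OF pq(2)] by blast
    \<comment> \<open>The block sizes ensure that the position (a, b) lies inside block (i, s),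
      where scaling acts entrywise.\<close>
    show "mat ?n ?n (\<lambda>(p, q). g (fst (block_index d L ! p)) * block_matrix d L d L R $$ (p, q) *
        g (fst (block_index d L ! q))) $$ (p, q) = selected_R L d R g $$ (p, q)"
      using pq ia sb R[OF ia(2) sb(2)] by (simp add: selected_R_def block_matrix_def)
  qed (auto simp: selected_R_def block_matrix_def)
  finally show ?thesis by simp
qed

text \<open>A congruence of a semidefinite pseudoinverse. The recursion uses nothing else about the
  sensor model than these two facts.\<close>

lemma information_matrix_pos_semidef:
  assumes R: "\<And>i s. i \<in> {1..L} \<Longrightarrow> s \<in> {1..L} \<Longrightarrow> R i s \<in> carrier_mat (d i) (d s)"
    and pd: "pos_def (block_matrix d L d L R)"
    and g: "\<And>i. i \<in> {1..L} \<Longrightarrow> g i \<in> {0, 1}"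
  shows "information_matrix r L d H R g \<in> carrier_mat r r"
    "pos_semidef (information_matrix r L d H R g)"
proof -
  let ?n = "length (block_index d L)"
  define D where "D = mat_diag ?n (\<lambda>p. g (fst (block_index d L ! p)))"
  have B: "block_matrix d L d L R \<in> carrier_mat ?n ?n" by (simp add: block_matrix_def)
  \<comment> \<open>The values 0 and 1 are idempotent, which makes \<open>D\<close> an orthogonal
    projection.\<close>
  have gg: "g (fst (block_index d L ! p)) * g (fst (block_index d L ! p)) =
      g (fst (block_index d L ! p))" if "p < ?n" for p
    using block_index_mem[OF that] g by (metis fst_conv insertE mult_1 mult_zero_left singletonD)
  have D: "D \<in> carrier_mat ?n ?n" "D\<^sup>T = D" "D * D = D"
    using gg by (auto simp: D_def mat_diag_diag) (auto simp: mat_diag_def intro!: eq_matI)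
  have sR: "selected_R L d R g = D * block_matrix d L d L R * D"
    unfolding D_def by (rule selected_R_eq[OF R])
  note X = pseudoinverse_compression[OF B pd D, folded sR]
  have H: "selected_H r L d H g \<in> carrier_mat ?n r"
    by (simp add: selected_H_def block_matrix_def length_block_index_1[simplified])
  show "information_matrix r L d H R g \<in> carrier_mat r r"
    using X H by (simp add: information_matrix_def)
  show "pos_semidef (information_matrix r L d H R g)"
    unfolding information_matrix_def by (rule pos_semidef_congruence[OF X H])
qed

section \<open>The covariance recursion\<close>

definition kalman_step :: "real mat \<Rightarrow> real mat \<Rightarrow> real mat \<Rightarrow> real mat \<Rightarrow> real mat" where
  "kalman_step F Q P S = mat_inv (mat_inv (F * P * F\<^sup>T + Q) + S)"

text \<open>Adding \<open>Q\<close> makes the prediction invertible even where \<open>P\<close> is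
  only semidefinite, as at the initial time.\<close>

lemma predicted_cov_pos_def:
  assumes "F \<in> carrier_mat r r" "Q \<in> carrier_mat r r" "pos_def Q"
    and "P \<in> carrier_mat r r" "pos_semidef P"
  shows "F * P * F\<^sup>T + Q \<in> carrier_mat r r" "pos_def (F * P * F\<^sup>T + Q)"
proof -
  have "F * P * F\<^sup>T \<in> carrier_mat r r" using assms by simp
  then show "pos_def (F * P * F\<^sup>T + Q)"
    by (rule pos_semidef_add_pos_def)
      (use assms pos_semidef_congruence' in auto)
qed (use assms in simp)

lemma updated_information_pos_def:
  assumes "A \<in> carrier_mat r r" "pos_def A" "S \<in> carrier_mat r r" "pos_semidef S"
  shows "mat_inv A + S \<in> carrier_mat r r" "pos_def (mat_inv A + S)"
proof -
  note B = pos_def_mat_inv[OF assms(1,2)]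
  show "pos_def (mat_inv A + S)"
    using pos_semidef_add_pos_def[OF assms(3,4) B(1,4)] comm_add_mat[OF B(1) assms(3)] by simp
qed (use assms in simp)

lemma kalman_step_pos_def:
  assumes "F \<in> carrier_mat r r" "Q \<in> carrier_mat r r" "pos_def Q"
    and "P \<in> carrier_mat r r" "pos_semidef P" "S \<in> carrier_mat r r" "pos_semidef S"
  shows "kalman_step F Q P S \<in> carrier_mat r r" "pos_def (kalman_step F Q P S)"
  unfolding kalman_step_def
  using pos_def_mat_inv updated_information_pos_def[OF predicted_cov_pos_def[OF assms(1-5)] assms(6,7)]
  by blast+

text \<open>Two inversions each reverse the order, so together they preserve it; additions and the
  congruence by the invertible \<open>F\<close> preserve and reflect it.\<close>

lemma kalman_step_loewner_ge_iff_left: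
  assumes F: "F \<in> carrier_mat r r" "invertible_mat F" and Q: "Q \<in> carrier_mat r r" "pos_def Q"
    and P: "P \<in> carrier_mat r r" "pos_semidef P" and P': "P' \<in> carrier_mat r r" "pos_semidef P'"
    and S: "S \<in> carrier_mat r r" "pos_semidef S"
  shows "kalman_step F Q P S \<succeq>\<^sub>L kalman_step F Q P' S \<longleftrightarrow> P \<succeq>\<^sub>L P'"
proof -
  let ?A = "F * P * F\<^sup>T + Q" and ?A' = "F * P' * F\<^sup>T + Q"
  note A = predicted_cov_pos_def[OF F(1) Q P] and A' = predicted_cov_pos_def[OF F(1) Q P']
  have "kalman_step F Q P S \<succeq>\<^sub>L kalman_step F Q P' S \<longleftrightarrow> mat_inv ?A' + S \<succeq>\<^sub>L mat_inv ?A + S"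
    unfolding kalman_step_def
    by (intro mat_inv_loewner_ge_iff[of _ r] updated_information_pos_def[of _ r] A A' S)
  also have "\<dots> \<longleftrightarrow> mat_inv ?A' \<succeq>\<^sub>L mat_inv ?A"
    by (intro loewner_ge_add_right_iff[of _ r] pos_def_mat_inv A A' S)
  also have "\<dots> \<longleftrightarrow> ?A \<succeq>\<^sub>L ?A'"
    by (intro mat_inv_loewner_ge_iff[of _ r] A A')
  also have "\<dots> \<longleftrightarrow> F * P * F\<^sup>T \<succeq>\<^sub>L F * P' * F\<^sup>T"
    by (intro loewner_ge_add_right_iff[of _ r] Q) (use F P P' in auto)
  also have "\<dots> \<longleftrightarrow> P \<succeq>\<^sub>L P'"
    by (intro loewner_ge_congruence_iff[of _ r] F P P')
  finally show ?thesis .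
qed

text \<open>Only the outer inversion touches the information matrix, so here the order is
  reversed.\<close>

lemma kalman_step_loewner_ge_iff_right:
  assumes F: "F \<in> carrier_mat r r" and Q: "Q \<in> carrier_mat r r" "pos_def Q"
    and P: "P \<in> carrier_mat r r" "pos_semidef P"
    and S: "S \<in> carrier_mat r r" "pos_semidef S" and S': "S' \<in> carrier_mat r r" "pos_semidef S'"
  shows "kalman_step F Q P S \<succeq>\<^sub>L kalman_step F Q P S' \<longleftrightarrow> S' \<succeq>\<^sub>L S"
proof -
  let ?A = "F * P * F\<^sup>T + Q"
  note A = predicted_cov_pos_def[OF F Q P]
  have "kalman_step F Q P S \<succeq>\<^sub>L kalman_step F Q P S' \<longleftrightarrow> mat_inv ?A + S' \<succeq>\<^sub>L mat_inv ?A + S"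
    unfolding kalman_step_def
    by (intro mat_inv_loewner_ge_iff[of _ r] updated_information_pos_def[of _ r] A S S')
  also have "\<dots> \<longleftrightarrow> S' \<succeq>\<^sub>L S"
    by (intro loewner_ge_add_left_iff[of _ r] pos_def_mat_inv A S S')
  finally show ?thesis .
qed

section \<open>The recursion over the whole horizon, for arbitrary semidefinite information
  matrices\<close>

locale covariance_recursion =
  fixes r k N :: nat and F Q :: "nat \<Rightarrow> real mat" and P\<^sub>0 :: "real mat"
  assumes F: "\<And>j. j \<in> {k..<k + N} \<Longrightarrow> F j \<in> carrier_mat r r \<and> invertible_mat (F j)"
    and Q: "\<And>j. j \<in> {k..<k + N} \<Longrightarrow> Q j \<in> carrier_mat r r \<and> pos_def (Q j)"
    and P\<^sub>0: "P\<^sub>0 \<in> carrier_mat r r" "pos_semidef P\<^sub>0"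
begin

definition admissible :: "(nat \<Rightarrow> real mat) \<Rightarrow> bool" where
  "admissible S \<longleftrightarrow> (\<forall>n\<in>{1..N}. S (k + n) \<in> carrier_mat r r \<and> pos_semidef (S (k + n)))"

lemma admissibleD:
  assumes "admissible S" "Suc n \<le> N"
  shows "S (k + Suc n) \<in> carrier_mat r r" "pos_semidef (S (k + Suc n))"
  using assms unfolding admissible_def by (metis Suc_le_mono atLeastAtMost_iff le0 One_nat_def)+

lemma FQ:
  assumes "Suc n \<le> N"
  shows "F (k + n) \<in> carrier_mat r r" "invertible_mat (F (k + n))"
    "Q (k + n) \<in> carrier_mat r r" "pos_def (Q (k + n))"
  using assms F[of "k + n"] Q[of "k + n"] by auto

abbreviation cov :: "(nat \<Rightarrow> real mat) \<Rightarrow> nat \<Rightarrow> real mat" where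
  "cov \<equiv> error_cov F Q k P\<^sub>0"

lemma cov_Suc: "cov S (Suc n) = kalman_step (F (k + n)) (Q (k + n)) (cov S n) (S (k + Suc n))"
  by (simp add: kalman_step_def)

text \<open>Semidefinite rather than definite, so that the induction can start at
  \<open>P\<^sub>0\<close>.\<close>

lemma cov_pos_semidef:
  assumes "admissible S" "n \<le> N"
  shows "cov S n \<in> carrier_mat r r \<and> pos_semidef (cov S n)"
  using assms(2)
proof (induction n)
  case (Suc n)
  note * = kalman_step_pos_def[OF FQ(1,3,4)[OF Suc.prems] _ _ admissibleD[OF assms(1) Suc.prems]]
  show ?case
    unfolding cov_Suc using * Suc pos_def_imp_pos_semidef by (metis Suc_leD)
qed (use P\<^sub>0 in simp)

lemma cov_cong:
  assumes "\<And>i. i \<in> {1..n} \<Longrightarrow> S (k + i) = S' (k + i)"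
  shows "cov S n = cov S' n"
  using assms
proof (induction n)
  case (Suc n)
  have "cov S n = cov S' n" using Suc by simp
  moreover have "S (k + Suc n) = S' (k + Suc n)" using Suc.prems[of "Suc n"] by simp
  ultimately show ?case by simp
qed simp

lemma cov_antimono:
  assumes S: "admissible S" and S': "admissible S'"
    and ge: "\<And>i. i \<in> {1..N} \<Longrightarrow> S' (k + i) \<succeq>\<^sub>L S (k + i)" and "n \<le> N"
  shows "cov S n \<succeq>\<^sub>L cov S' n"
  using \<open>n \<le> N\<close>
proof (induction n)
  case 0
  show ?case using loewner_ge_refl[OF P\<^sub>0(1)] by simp
next
  case (Suc n)
  note FQ = FQ[OF Suc.prems] and s = admissibleD[OF S Suc.prems] and s' = admissibleD[OF S' Suc.prems]
  have n: "n \<le> N" using Suc by simp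
  have c: "cov S n \<in> carrier_mat r r" "pos_semidef (cov S n)"
    "cov S' n \<in> carrier_mat r r" "pos_semidef (cov S' n)"
    using cov_pos_semidef[OF _ n] S S' by auto
  let ?f = "kalman_step (F (k + n)) (Q (k + n))"
  \<comment> \<open>The two steps are compared through an intermediate one, which already has the
    covariance of \<open>S'\<close> but still the information of \<open>S\<close>.\<close>
  have 1: "?f (cov S n) (S (k + Suc n)) \<succeq>\<^sub>L ?f (cov S' n) (S (k + Suc n))"
    using Suc n kalman_step_loewner_ge_iff_left[OF FQ c s] by simp
  have 2: "?f (cov S' n) (S (k + Suc n)) \<succeq>\<^sub>L ?f (cov S' n) (S' (k + Suc n))"
    using ge[of "Suc n"] Suc.prems kalman_step_loewner_ge_iff_right[OF FQ(1,3,4) c(3,4) s s'] by simp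
  show ?case
    unfolding cov_Suc
    by (rule loewner_ge_trans[of _ r, OF _ _ _ 1 2]; intro kalman_step_pos_def(1) FQ c s s')
qed

text \<open>
  Changing the information at a single time: each later step reflects the Loewner order, so the
  comparison of the final covariances can be pulled back to the time of the change.
\<close>

lemma cov_reflect:
  assumes S: "admissible S" and S': "admissible S'"
    and eq: "\<And>i. i \<noteq> n \<Longrightarrow> S (k + i) = S' (k + i)" and n: "n \<in> {1..l}" and "l \<le> N"
    and ge: "cov S l \<succeq>\<^sub>L cov S' l"
  shows "S' (k + n) \<succeq>\<^sub>L S (k + n)"
  using n \<open>l \<le> N\<close> ge
proof (induction l)
  case (Suc l)
  note FQ = FQ[OF Suc.prems(2)] and s = admissibleD[OF S Suc.prems(2)]
    and s' = admissibleD[OF S' Suc.prems(2)]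
  have l: "l \<le> N" using Suc by simp
  have c: "cov S l \<in> carrier_mat r r" "pos_semidef (cov S l)"
    "cov S' l \<in> carrier_mat r r" "pos_semidef (cov S' l)"
    using cov_pos_semidef[OF _ l] S S' by auto
  \<comment> \<open>At the time of the change the preceding covariances agree, so the comparison
    concerns the information alone. At any later time the information agrees and the comparison
    moves back one step.\<close>
  show ?case
  proof (cases "n = Suc l")
    case True
    then have "cov S l = cov S' l" by (intro cov_cong eq) auto
    then show ?thesis
      using Suc.prems(3) kalman_step_loewner_ge_iff_right[OF FQ(1,3,4) c(1,2) s s'] True
      unfolding cov_Suc by simp
  next
    case False
    then have "S (k + Suc l) = S' (k + Suc l)" by (intro eq) auto
    then have "cov S l \<succeq>\<^sub>L cov S' l"
      using Suc.prems(3) kalman_step_loewner_ge_iff_left[OF FQ c s] unfolding cov_Suc by simp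
    then show ?thesis using Suc False by auto
  qed
qed simp

end

section \<open>Equivalence of the selection problems\<close>

lemma finsum_mat_carrier:
  assumes "finite I" "\<And>i. i \<in> I \<Longrightarrow> A i \<in> carrier_mat n n"
  shows "finsum (module_mat TYPE(real) n n) A I \<in> carrier_mat n n"
proof -
  interpret abelian_group "module_mat TYPE(real) n n" by (rule abelian_group_mat)
  show ?thesis using finsum_closed[of A I] assms by (auto simp: module_mat_simps)
qed

lemma finsum_mat_insert:
  assumes "finite I" "a \<notin> I" "\<And>i. i \<in> insert a I \<Longrightarrow> A i \<in> carrier_mat n n"
  shows "finsum (module_mat TYPE(real) n n) A (insert a I) =
    A a + finsum (module_mat TYPE(real) n n) A I"
proof -
  interpret abelian_group "module_mat TYPE(real) n n" by (rule abelian_group_mat)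
  show ?thesis using finsum_insert[of I a A] assms by (auto simp: module_mat_simps)
qed

lemma finsum_mat_empty: "finsum (module_mat TYPE(real) n n) A {} = 0\<^sub>m n n"
proof -
  interpret abelian_group "module_mat TYPE(real) n n" by (rule abelian_group_mat)
  show ?thesis using finsum_empty by (auto simp: module_mat_simps)
qed

lemma mat_trace_finsum:
  assumes "finite I" "\<And>i. i \<in> I \<Longrightarrow> A i \<in> carrier_mat n n"
  shows "mat_trace (finsum (module_mat TYPE(real) n n) A I) = (\<Sum>i\<in>I. mat_trace (A i))"
  using assms
proof (induction I)
  case empty
  then show ?case by (simp add: finsum_mat_empty mat_trace_def)
next
  case (insert a I)
  have "mat_trace (A a + B) = mat_trace (A a) + mat_trace B" if "B \<in> carrier_mat n n" for B
    using that insert.prems[of a] by (auto simp: mat_trace_def sum.distrib)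
  then show ?case
    using insert finsum_mat_carrier[of I A n] finsum_mat_insert[of I a A n] by simp
qed

lemma finsum_mat_loewner_ge:
  assumes "finite I" "\<And>i. i \<in> I \<Longrightarrow> A i \<in> carrier_mat n n" "\<And>i. i \<in> I \<Longrightarrow> B i \<in> carrier_mat n n"
    "\<And>i. i \<in> I \<Longrightarrow> A i \<succeq>\<^sub>L B i"
  shows "finsum (module_mat TYPE(real) n n) A I \<succeq>\<^sub>L finsum (module_mat TYPE(real) n n) B I"
  using assms
proof (induction I)
  case empty
  then show ?case by (simp add: finsum_mat_empty loewner_ge_refl[of _ n])
next
  case (insert a I)
  then show ?case
    using finsum_mat_carrier[of I A n] finsum_mat_carrier[of I B n]
      finsum_mat_insert[of I a A n] finsum_mat_insert[of I a B n]
    by (simp add: loewner_ge_add[of _ n])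
qed

section \<open>Comparison of the three problems\<close>

theorem theorem3p5:
  fixes k N r L :: nat
    and m d :: "nat \<Rightarrow> nat"
    and F Q :: "nat \<Rightarrow> real mat"
    and H :: "nat \<Rightarrow> nat \<Rightarrow> real mat"
    and R :: "nat \<Rightarrow> nat \<Rightarrow> nat \<Rightarrow> real mat"
    and P\<^sub>0 :: "real mat"
    and S :: "nat \<Rightarrow> (nat \<Rightarrow> real) \<Rightarrow> real mat"
    and P :: "(nat \<Rightarrow> nat \<Rightarrow> real) \<Rightarrow> nat \<Rightarrow> real mat"
    and feasible optF optA optT :: "(nat \<Rightarrow> nat \<Rightarrow> real) \<Rightarrow> bool"
  assumes N: "N \<ge> 1"
    and m: "\<And>n. n \<in> {1..N} \<Longrightarrow> m (k + n) \<le> L"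
    and F: "\<And>j. j \<in> {k..<k + N} \<Longrightarrow> F j \<in> carrier_mat r r \<and> invertible_mat (F j)"
    and Q: "\<And>j. j \<in> {k..<k + N} \<Longrightarrow> Q j \<in> carrier_mat r r \<and> pos_def (Q j)"
    and H: "\<And>j i. j \<in> {k + 1..k + N} \<Longrightarrow> i \<in> {1..L} \<Longrightarrow> H j i \<in> carrier_mat (d i) r"
    and R_block: "\<And>j i s. j \<in> {k + 1..k + N} \<Longrightarrow> i \<in> {1..L} \<Longrightarrow> s \<in> {1..L} \<Longrightarrow>
          R j i s \<in> carrier_mat (d i) (d s)"
    and R: "\<And>j. j \<in> {k + 1..k + N} \<Longrightarrow> pos_def (block_matrix d L d L (R j))"
    and P\<^sub>0: "P\<^sub>0 \<in> carrier_mat r r" "pos_semidef P\<^sub>0"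
    and S_def: "\<And>j g. S j g = information_matrix r L d (H j) (R j) g"
    and P_def: "\<And>\<gamma> n. P \<gamma> n = error_cov F Q k P\<^sub>0 (\<lambda>j. S j (\<gamma> j)) n"
    and feasible_def: "\<And>\<gamma>. feasible \<gamma> \<longleftrightarrow>
          (\<forall>n\<in>{1..N}. feasible_selection L (m (k + n)) (\<gamma> (k + n)))"
    and optF_def: "\<And>\<gamma>. optF \<gamma> \<longleftrightarrow> is_loewner_min feasible (\<lambda>\<gamma>. P \<gamma> N) \<gamma>"
    and optA_def: "\<And>\<gamma>. optA \<gamma> \<longleftrightarrow>
          is_loewner_min feasible (\<lambda>\<gamma>. finsum (module_mat TYPE(real) r r) (P \<gamma>) {1..N}) \<gamma>"
    and optT_def: "\<And>\<gamma>. optT \<gamma> \<longleftrightarrow>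
          (\<forall>n\<in>{1..N}. is_arg_max (\<lambda>g. mat_trace (S (k + n) g))
             (feasible_selection L (m (k + n))) (\<gamma> (k + n)))"
    and F_solvable: "\<exists>\<gamma>. optF \<gamma>"
  shows "\<forall>\<gamma>. (optF \<gamma> \<longleftrightarrow> optA \<gamma>) \<and> (optA \<gamma> \<longleftrightarrow> optT \<gamma>)"
proof -
  interpret covariance_recursion r k N F Q P\<^sub>0
    by unfold_locales (use F Q P\<^sub>0 in auto)
  define T where "T \<gamma> = (\<lambda>j. S j (\<gamma> j))" for \<gamma> :: "nat \<Rightarrow> nat \<Rightarrow> real"
  have P: "P \<gamma> n = cov (T \<gamma>) n" for \<gamma> n by (simp add: P_def T_def)
  have S: "S (k + n) g \<in> carrier_mat r r" "pos_semidef (S (k + n) g)"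
    if "n \<in> {1..N}" "feasible_selection L (m (k + n)) g" for n g
  proof -
    have j: "k + n \<in> {k + 1..k + N}" using that by auto
    have g: "\<And>i. i \<in> {1..L} \<Longrightarrow> g i \<in> {0, 1}" using that by (simp add: feasible_selection_def)
    note info = information_matrix_pos_semidef[of L "R (k + n)" d g r "H (k + n)"]
    show "S (k + n) g \<in> carrier_mat r r"
      unfolding S_def by (rule info(1)) (use R_block[OF j] R[OF j] g in blast)+
    show "pos_semidef (S (k + n) g)"
      unfolding S_def by (rule info(2)) (use R_block[OF j] R[OF j] g in blast)+
  qed
  have adm: "admissible (T \<gamma>)" if "feasible \<gamma>" for \<gamma>
    using that S unfolding admissible_def T_def feasible_def by blast
  have P_carrier: "P \<gamma> n \<in> carrier_mat r r" if "feasible \<gamma>" "n \<in> {1..N}" for \<gamma> n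
    using that cov_pos_semidef[OF adm] by (simp add: P)
  let ?sum = "\<lambda>\<gamma>. finsum (module_mat TYPE(real) r r) (P \<gamma>) {1..N}"
  have sum_carrier: "?sum \<gamma> \<in> carrier_mat r r" if "feasible \<gamma>" for \<gamma>
    using that P_carrier by (intro finsum_mat_carrier) auto
  have trace_sum: "mat_trace (?sum \<gamma>) = (\<Sum>n\<in>{1..N}. mat_trace (P \<gamma> n))" if "feasible \<gamma>" for \<gamma>
    using that P_carrier by (intro mat_trace_finsum) auto
  \<comment> \<open>Exchange argument: the constraints couple only sensors of the same time, so
    replacing the selection at time k + n keeps the family feasible. Optimality of the final
    covariance is then pulled back by \<open>cov_reflect\<close>.\<close>
  have max: "S (k + n) (\<gamma> (k + n)) \<succeq>\<^sub>L S (k + n) g"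
    if opt: "optF \<gamma>" and n: "n \<in> {1..N}" and g: "feasible_selection L (m (k + n)) g" for \<gamma> n g
  proof -
    define \<gamma>' where "\<gamma>' = \<gamma>(k + n := g)"
    have f: "feasible \<gamma>" using opt by (simp add: optF_def is_loewner_min_def)
    then have f': "feasible \<gamma>'" using g by (auto simp: feasible_def \<gamma>'_def)
    then have "cov (T \<gamma>') N \<succeq>\<^sub>L cov (T \<gamma>) N"
      using opt by (simp add: optF_def is_loewner_min_def P)
    from cov_reflect[OF adm[OF f'] adm[OF f] _ n order.refl this]
    have "T \<gamma> (k + n) \<succeq>\<^sub>L T \<gamma>' (k + n)" by (auto simp: T_def \<gamma>'_def)
    then show ?thesis by (simp add: T_def \<gamma>'_def)
  qed
  obtain \<delta> where \<delta>: "optF \<delta>" using F_solvable by blast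
  then have f\<delta>: "feasible \<delta>" by (simp add: optF_def is_loewner_min_def)
  then have sel\<delta>: "feasible_selection L (m (k + n)) (\<delta> (k + n))" if "n \<in> {1..N}" for n
    using that by (simp add: feasible_def)
  \<comment> \<open>The maximal information of \<delta> at every time makes each of its covariances
    minimal, not only the final one.\<close>
  have P_min: "P \<gamma> n \<succeq>\<^sub>L P \<delta> n" if "feasible \<gamma>" "n \<in> {1..N}" for \<gamma> n
    unfolding P using that adm f\<delta> max[OF \<delta>]
    by (intro cov_antimono) (auto simp: T_def feasible_def)
  \<comment> \<open>The common description of all three solution sets. Optimal selections may differ
    from \<delta>; only their information matrices are determined.\<close>
  define good where "good \<gamma> \<longleftrightarrow>
    feasible \<gamma> \<and> (\<forall>n\<in>{1..N}. S (k + n) (\<gamma> (k + n)) = S (k + n) (\<delta> (k + n)))" for \<gamma>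
  have good_P: "P \<gamma> n = P \<delta> n" if "good \<gamma>" "n \<in> {1..N}" for \<gamma> n
    unfolding P using that by (intro cov_cong) (auto simp: good_def T_def)
  have F_iff: "optF \<gamma> \<longleftrightarrow> good \<gamma>" for \<gamma>
  proof
    assume \<gamma>: "optF \<gamma>"
    then have f: "feasible \<gamma>" by (simp add: optF_def is_loewner_min_def)
    \<comment> \<open>Each of two optimal families dominates the other at every time.\<close>
    have "S (k + n) (\<gamma> (k + n)) = S (k + n) (\<delta> (k + n))" if n: "n \<in> {1..N}" for n
    proof -
      have sel: "feasible_selection L (m (k + n)) (\<gamma> (k + n))" using f n by (simp add: feasible_def)
      show ?thesis
        using max[OF \<gamma> n sel\<delta>[OF n]] max[OF \<delta> n sel] S(1)[OF n sel] S(1)[OF n sel\<delta>[OF n]]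
        by (intro loewner_ge_antisym)
    qed
    then show "good \<gamma>" using f by (simp add: good_def)
  next
    assume "good \<gamma>"
    then show "optF \<gamma>"
      using \<delta> good_P[of \<gamma> N] N by (auto simp: optF_def is_loewner_min_def good_def)
  qed
  have A_iff: "optA \<gamma> \<longleftrightarrow> good \<gamma>" for \<gamma>
  proof
    assume \<gamma>: "optA \<gamma>"
    then have f: "feasible \<gamma>" and ge: "?sum \<delta> \<succeq>\<^sub>L ?sum \<gamma>"
      using f\<delta> by (auto simp: optA_def is_loewner_min_def)
    have tr: "mat_trace (P \<delta> n) \<le> mat_trace (P \<gamma> n)" if "n \<in> {1..N}" for n
      using loewner_ge_trace P_carrier P_min f f\<delta> that by blast
    have "(\<Sum>n\<in>{1..N}. mat_trace (P \<gamma> n)) \<le> (\<Sum>n\<in>{1..N}. mat_trace (P \<delta> n))"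
      using loewner_ge_trace[OF sum_carrier[OF f\<delta>] sum_carrier[OF f] ge]
      unfolding trace_sum[OF f] trace_sum[OF f\<delta>] .
    \<comment> \<open>Every trace for \<gamma> is at least the one for \<delta>, while the sums
      compare the other way. So no term is strictly larger, in particular not the last.\<close>
    then have "mat_trace (P \<gamma> N) \<le> mat_trace (P \<delta> N)"
      using sum_strict_mono_ex1[of "{1..N}" "\<lambda>n. mat_trace (P \<delta> n)" "\<lambda>n. mat_trace (P \<gamma> n)"] tr N
      by (meson atLeastAtMost_iff finite_atLeastAtMost linorder_not_less order.refl)
    then have "P \<gamma> N = P \<delta> N"
      using N f f\<delta> by (intro loewner_ge_trace_eq[OF P_carrier P_carrier P_min]) auto
    \<comment> \<open>Agreement of the final covariances already gives optimality for (F);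
      \<open>F_iff\<close> then recovers the information matrices at all times.\<close>
    then have "optF \<gamma>" using \<delta> f by (simp add: optF_def is_loewner_min_def)
    then show "good \<gamma>" by (simp add: F_iff)
  next
    assume g: "good \<gamma>"
    have f: "feasible \<gamma>" using g by (simp add: good_def)
    have "?sum \<epsilon> \<succeq>\<^sub>L ?sum \<gamma>" if "feasible \<epsilon>" for \<epsilon>
      using that f f\<delta> P_carrier P_min good_P[OF g] by (intro finsum_mat_loewner_ge) auto
    then show "optA \<gamma>" using f by (simp add: optA_def is_loewner_min_def)
  qed
  have T_iff: "optT \<gamma> \<longleftrightarrow> good \<gamma>" for \<gamma>
  proof -
    have "is_arg_max (\<lambda>g. mat_trace (S (k + n) g)) (feasible_selection L (m (k + n))) h \<longleftrightarrow>
        feasible_selection L (m (k + n)) h \<and> S (k + n) h = S (k + n) (\<delta> (k + n))"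
      if n: "n \<in> {1..N}" for n h
    proof -
      have le: "mat_trace (S (k + n) g) \<le> mat_trace (S (k + n) (\<delta> (k + n)))"
        if "feasible_selection L (m (k + n)) g" for g
        using loewner_ge_trace max[OF \<delta> n] S(1)[OF n] sel\<delta>[OF n] that by blast
      \<comment> \<open>A maximizer of the trace lies below \<delta> in the Loewner order but has no
        smaller trace, so the two information matrices coincide.\<close>
      have "S (k + n) h = S (k + n) (\<delta> (k + n))"
        if "feasible_selection L (m (k + n)) h"
          "mat_trace (S (k + n) (\<delta> (k + n))) \<le> mat_trace (S (k + n) h)"
        using loewner_ge_trace_eq[OF S(1)[OF n sel\<delta>[OF n]] S(1)[OF n] max[OF \<delta> n]] that by metis
      then show ?thesis
        using le sel\<delta>[OF n] unfolding is_arg_max_def by (metis linorder_not_less)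
    qed
    then show ?thesis by (auto simp: optT_def good_def feasible_def)
  qed
  show ?thesis using F_iff A_iff T_iff by simp
qed

end
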